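(* Let $(\mathcal S,d_{\mathcal S})$ be a metric space of predictive states, let $R,\epsilon,\delta>0$, and let $E:\mathcal S\to\mathbb R^d$ satisfy $E(\mathcal S)\subseteq[-R,R]^d$. Suppose a decoder $C:\mathbb R^d\to\mathcal S$ obeys $d_{\mathcal S}(C(E(s)+\eta),s)\le\delta$ for all $s\in\mathcal S$ and all $\eta\in\mathbb R^d$ with $\lVert\eta\rVert_\infty\le\epsilon$. Then $$M_{\mathcal S}(2\delta)\le\left(1+\frac R\epsilon\right)^d,\qquad d\ge\frac{\log M_{\mathcal S}(2\delta)}{\log(1+R/\epsilon)}.$$
   Context: $M_{\mathcal S}(r)$ denotes the $r$-packing number of $(\mathcal S,d_{\mathcal S})$: the maximal cardinality of a subset of $\mathcal S$ whose distinct elements are pairwise at $d_{\mathcal S}$-distance strictly greater than $r$. *)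

theory Defs
  imports "HOL-Analysis.Analysis"
begin

definition packing_set :: "'a set \<Rightarrow> ('a \<Rightarrow> 'a \<Rightarrow> real) \<Rightarrow> real \<Rightarrow> 'a set \<Rightarrow> bool" where
  "packing_set S dS r A \<longleftrightarrow> A \<subseteq> S \<and> (\<forall>x\<in>A. \<forall>y\<in>A. x \<noteq> y \<longrightarrow> dS x y > r)"

text \<open>The packing number takes values in \<^typ>\<open>enat\<close>, since \<^const>\<open>card\<close> is 0 on infinite sets.
  A finite supremum in \<^typ>\<open>enat\<close> is attained, so it is then the maximal cardinality.\<close>

definition packing_number :: "'a set \<Rightarrow> ('a \<Rightarrow> 'a \<Rightarrow> real) \<Rightarrow> real \<Rightarrow> enat" where
  "packing_number S dS r =
     (SUP A\<in>{A. packing_set S dS r A}. if finite A then enat (card A) else \<infinity>)"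

end

theory Submission
  imports Defs
begin

text \<open>If \<open>E s\<close> and \<open>E t\<close> lie within \<open>2 \<epsilon>\<close> in the supremum norm, their midpoint is an
  admissible perturbation of both, so decoding it shows \<open>dS s t \<le> 2 \<delta>\<close>. Hence \<open>E\<close> sends distinct
  points of a packing to distinct cells of the grid of mesh \<open>2 \<epsilon>\<close>, and \<open>[-R,R]\<close> meets at most
  \<open>1 + R / \<epsilon>\<close> cells per coordinate.\<close>

lemma infnorm_le_cart:
  fixes x :: "real ^ 'n"
  assumes "\<And>i. \<bar>x $ i\<bar> \<le> b"
  shows "infnorm x \<le> b"
  unfolding infnorm_cart by (rule cSup_least) (use assms in auto)

lemma robust_decoder_dist_le:
  fixes E :: "'s \<Rightarrow> real ^ 'd"
  assumes "Metric_space S dS" "range C \<subseteq> S"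
    and dec: "\<And>s \<eta>. s \<in> S \<Longrightarrow> infnorm \<eta> \<le> \<epsilon> \<Longrightarrow> dS (C (E s + \<eta>)) s \<le> \<delta>"
    and "s \<in> S" "t \<in> S" and close: "infnorm (E t - E s) \<le> 2 * \<epsilon>"
  shows "dS s t \<le> 2 * \<delta>"
proof -
  interpret Metric_space S dS by fact
  define h where "h = (1/2) *\<^sub>R (E t - E s)"
  have h: "infnorm h \<le> \<epsilon>" "infnorm (- h) \<le> \<epsilon>"
    using close by (simp_all add: h_def infnorm_mul infnorm_neg del: scaleR_minus_left)
  have "E t + - h = E s + h"
    by (simp add: h_def vec_eq_iff field_simps)
  then have "dS (C (E s + h)) s \<le> \<delta>" "dS (C (E s + h)) t \<le> \<delta>"
    using dec[OF \<open>s \<in> S\<close> h(1)] dec[OF \<open>t \<in> S\<close> h(2)] by metis+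
  \<comment> \<open>The triangle inequality is available only inside the carrier \<open>S\<close>;
    \<open>range C \<subseteq> S\<close> puts the decoded midpoint there.\<close>
  moreover have "dS s t \<le> dS (C (E s + h)) s + dS (C (E s + h)) t"
    using triangle[of s "C (E s + h)" t] assms by (auto simp: commute)
  ultimately show ?thesis by simp
qed

text \<open>Pigeonhole on cell indices. Shifting by \<open>R\<close> and dividing by
  \<open>2 * \<epsilon>\<close> moves each coordinate into \<open>[0, R / \<epsilon>]\<close>, where
  the floor takes one of the values \<open>0, ..., \<lfloor>R / \<epsilon>\<rfloor>\<close>; the
  \<open>+ 1\<close> counts the index 0.\<close>

lemma card_separated_in_cube:
  fixes f :: "'s \<Rightarrow> real ^ 'd"
  assumes "R \<ge> 0" "\<epsilon> > 0"
    and cube: "\<And>s i. s \<in> A \<Longrightarrow> f s $ i \<in> {-R..R}"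
    and sep: "\<And>s t. s \<in> A \<Longrightarrow> t \<in> A \<Longrightarrow> s \<noteq> t \<Longrightarrow> infnorm (f t - f s) > 2 * \<epsilon>"
  shows "finite A \<and> card A \<le> (nat \<lfloor>R / \<epsilon>\<rfloor> + 1) ^ CARD('d)"
proof -
  define q where "q s = (\<lambda>i. \<lfloor>(f s $ i + R) / (2 * \<epsilon>)\<rfloor>)" for s
  define B where "B = (UNIV :: 'd set) \<rightarrow>\<^sub>E {0..\<lfloor>R / \<epsilon>\<rfloor>}"
  have "inj_on q A"
  proof (rule inj_onI, rule ccontr)
    fix s t assume st: "s \<in> A" "t \<in> A" "q s = q t" "s \<noteq> t"
    have "\<bar>(f t - f s) $ i\<bar> \<le> 2 * \<epsilon>" for i
    proof -
      have "\<lfloor>(f s $ i + R) / (2 * \<epsilon>)\<rfloor> = \<lfloor>(f t $ i + R) / (2 * \<epsilon>)\<rfloor>"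
        using st(3) unfolding q_def by metis
      \<comment> \<open>Reals with equal floors differ by less than 1. The weak bound is enough,
        since the separation is strict.\<close>
      then have "\<bar>(f t $ i + R) / (2 * \<epsilon>) - (f s $ i + R) / (2 * \<epsilon>)\<bar> \<le> 1"
        by linarith
      also have "(f t $ i + R) / (2 * \<epsilon>) - (f s $ i + R) / (2 * \<epsilon>) = (f t - f s) $ i / (2 * \<epsilon>)"
        by (simp add: diff_divide_distrib add_divide_distrib)
      finally show ?thesis
        using \<open>\<epsilon> > 0\<close> by (simp add: abs_divide divide_le_eq)
    qed
    then show False
      using sep[OF st(1,2,4)] infnorm_le_cart by (metis not_le)
  qed
  moreover have "q ` A \<subseteq> B"
  proof -
    have "(f s $ i + R) / (2 * \<epsilon>) \<in> {0..R / \<epsilon>}" if "s \<in> A" for s i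
      using cube[OF that, of i] \<open>\<epsilon> > 0\<close> by (simp add: field_simps)
    then show ?thesis
      by (auto simp: q_def B_def intro!: floor_mono)
  qed
  moreover have "finite B" "card B = (nat \<lfloor>R / \<epsilon>\<rfloor> + 1) ^ CARD('d)"
    using assms by (simp_all add: B_def finite_PiE card_PiE nat_add_distrib)
  ultimately show ?thesis
    by (metis card_inj_on_le inj_on_finite)
qed

theorem theorem4:
  fixes S :: "'s set" and dS :: "'s \<Rightarrow> 's \<Rightarrow> real"
    and R \<epsilon> \<delta> :: real
    and E :: "'s \<Rightarrow> real ^ 'd" and C :: "real ^ 'd \<Rightarrow> 's"
  assumes "Metric_space S dS"
    and "R > 0" and "\<epsilon> > 0" and "\<delta> > 0"
    and "E ` S \<subseteq> {x. \<forall>i. x $ i \<in> {-R..R}}"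
    and "range C \<subseteq> S"
    and "\<And>s \<eta>. s \<in> S \<Longrightarrow> infnorm \<eta> \<le> \<epsilon> \<Longrightarrow> dS (C (E s + \<eta>)) s \<le> \<delta>"
  shows "ereal_of_enat (packing_number S dS (2 * \<delta>)) \<le> ereal ((1 + R / \<epsilon>) ^ CARD('d)) \<and>
    real CARD('d) \<ge> ln (real (the_enat (packing_number S dS (2 * \<delta>)))) / ln (1 + R / \<epsilon>)"
proof -
  define K where "K = nat \<lfloor>R / \<epsilon>\<rfloor> + 1"
  define P where "P = packing_number S dS (2 * \<delta>)"
  \<comment> \<open>Finiteness of every packing rules out the value \<open>\<infinity>\<close> in
    the supremum.\<close>
  have "finite A \<and> card A \<le> K ^ CARD('d)" if "packing_set S dS (2 * \<delta>) A" for A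
    unfolding K_def
  proof (rule card_separated_in_cube)
    show "E s $ i \<in> {-R..R}" if "s \<in> A" for s i
      using that assms(5) \<open>packing_set S dS (2 * \<delta>) A\<close> unfolding packing_set_def by blast
    show "infnorm (E t - E s) > 2 * \<epsilon>" if "s \<in> A" "t \<in> A" "s \<noteq> t" for s t
      using robust_decoder_dist_le[OF assms(1,6,7), where s = s and t = t] that
        \<open>packing_set S dS (2 * \<delta>) A\<close> unfolding packing_set_def by (meson not_le subsetD)
  qed (use assms in auto)
  then have "P \<le> enat (K ^ CARD('d))"
    unfolding P_def packing_number_def by (auto intro!: SUP_least)
  \<comment> \<open>The bound is uniform over packings, so \<open>P\<close> is finite and
    \<open>the_enat\<close> returns its true value \<open>n\<close>.\<close>
  then obtain n where n: "P = enat n" "n \<le> K ^ CARD('d)"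
    by (cases P) auto
  have "real n \<le> real K ^ CARD('d)"
    using n(2) by (metis of_nat_le_iff of_nat_power)
  also have "\<dots> \<le> (1 + R / \<epsilon>) ^ CARD('d)"
    using assms by (intro power_mono) (auto simp: K_def)
  finally have bound: "real n \<le> (1 + R / \<epsilon>) ^ CARD('d)" .
  \<comment> \<open>Strictness makes \<open>ln (1 + R / \<epsilon>)\<close> positive, so dividing by
    it keeps the inequality.\<close>
  have base: "1 + R / \<epsilon> > 1"
    using assms by simp
  have "ln (real n) \<le> real CARD('d) * ln (1 + R / \<epsilon>)"
  \<comment> \<open>Monotonicity of \<open>ln\<close> is applied to positive arguments only; for
    \<open>n = 0\<close> the convention \<open>ln 0 = 0\<close> leaves a nonnegative right-hand side
    to check.\<close>
  proof (cases "n = 0")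
    case True
    then show ?thesis using base by simp
  next
    case False
    then have "ln (real n) \<le> ln ((1 + R / \<epsilon>) ^ CARD('d))"
      using bound base by (intro ln_mono) auto
    then show ?thesis
      using base by (simp add: ln_realpow)
  qed
  then have "ln (real n) / ln (1 + R / \<epsilon>) \<le> real CARD('d)"
    using base by (simp add: divide_le_eq)
  then show ?thesis
    using bound n(1) by (simp add: P_def)
qed

end
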